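(* Let $s_1,s_2,s_3$ be positive integers such that $w:=s_1+s_2+s_3$ is odd, and let $p>w$ be a prime. Then $$\sum_{j=1}^{p-1}\frac{H_j^{(s_1)}H_j^{(s_3)}}{j^{s_2}}\equiv \left[\frac{(-1)^{s_1+1}}{2w}\binom{w}{s_1}+\frac{(-1)^{s_3}+2(-1)^{s_1+s_2}}{2w}\binom{w}{s_3}\right]B_{p-w}\pmod p.$$
   Context: For positive integers $s$ and $n\ge 0$, $H_n^{(s)}=\sum_{k=1}^{n}\frac{1}{k^s}$. $(B_n)_{n\ge 0}$ is the sequence of Bernoulli numbers. Congruences modulo $p$ are between rational numbers whose denominators are prime to $p$. *)

theory Defs
  imports Complex_Main "HOL-Computational_Algebra.Primes"
begin

definition gen_harm :: "nat \<Rightarrow> nat \<Rightarrow> rat" where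
  "gen_harm s n = (\<Sum>k=1..n. 1 / of_nat k ^ s)"

text \<open>
  The recurrence \<open>\<Sum>k\<le>n. (n + 1 choose k) B\<^sub>k = 0\<close> for \<open>n > 0\<close>, solved for \<open>B\<^sub>n\<close>.
  This is the convention \<open>B\<^sub>1 = - 1 / 2\<close>, that is, \<open>x / (exp x - 1) = (\<Sum>n. B\<^sub>n x\<^sup>n / n!)\<close>.
\<close>
fun bernoulli :: "nat \<Rightarrow> rat" where
  "bernoulli n =
     (if n = 0 then 1
      else - (\<Sum>k<n. of_nat ((n + 1) choose k) * bernoulli k) / of_nat (n + 1))"

declare bernoulli.simps [simp del]

definition p_integral :: "nat \<Rightarrow> rat \<Rightarrow> bool" where
  "p_integral p x \<longleftrightarrow> coprime (snd (quotient_of x)) (int p)"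

text \<open>
  The congruence relates \<open>p\<close>-integral rationals only, so asserting it
  includes the claim that both sides have denominator prime to \<open>p\<close>.
\<close>
definition rat_cong :: "rat \<Rightarrow> rat \<Rightarrow> nat \<Rightarrow> bool" where
  "rat_cong x y p \<longleftrightarrow> p_integral p x \<and> p_integral p y \<and> int p dvd fst (quotient_of (x - y))"

end

theory Submission
  imports Defs "HOL-Number_Theory.Residues"
begin

text \<open>
  Write \<open>H s j\<close> for \<open>gen_harm s j\<close>, and let \<open>w = a + b + c\<close> be odd. The sum
  \<open>S = (\<Sum>j. H a j * H c j / j ^ b)\<close> is determined by its behaviour under \<open>j \<mapsto> p - j\<close>. Modulo \<open>p\<close>, the
  terms of \<open>H s (p - j)\<close> are, up to the sign \<open>(- 1) ^ s\<close>, those of \<open>H s (p - 1)\<close> beyond the index \<open>j - 1\<close>.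
  Since \<open>H s (p - 1)\<close> vanishes, \<open>H s (p - j)\<close> is \<open>(- 1) ^ (s + 1) * H s (j - 1)\<close> (\<open>gen_harm_reflect\<close>).
  Because \<open>w\<close> is odd, \<open>S\<close> is therefore congruent to minus the same sum with \<open>H s (j - 1)\<close> in place of
  \<open>H s j\<close>. Expanding \<open>H s (j - 1) = H s j - 1 / j ^ s\<close> gives \<open>- S\<close> plus two sums with a single harmonic
  number, minus \<open>\<Sum>j. 1 / j ^ w\<close>, which vanishes. Hence \<open>2 * S\<close> is congruent to the sum of those two
  (\<open>triple_harmonic_sum_reduction\<close>).

  The sums \<open>\<Sum>j. H a j / j ^ m\<close> with \<open>a + m = w\<close> are evaluated in \<open>double_harmonic_sum\<close>. By Fermat's theorem
  \<open>1 / k ^ a\<close> may be replaced by \<open>k ^ (p - 1 - a)\<close>, so Faulhaber's formula turns the harmonic number into a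
  polynomial in \<open>j\<close> whose coefficients are \<open>p\<close>-integral multiples of Bernoulli numbers \<open>bernoulli i\<close> with
  \<open>i < p - 1\<close>, which are themselves \<open>p\<close>-integral. A power sum over \<open>1, \<dots>, p - 1\<close> vanishes unless \<open>p - 1\<close>
  divides the exponent (\<open>power_sum_rat_cong\<close>), and this selects the single index \<open>i = p - w\<close>. Its binomial
  coefficient \<open>(p - a) choose m\<close> is congruent to the value at \<open>- a\<close> of the corresponding polynomial
  (\<open>binomial_rat_cong\<close>).

  Faulhaber's formula also supplies the vanishing of the power sums: for \<open>n < p - 1\<close> it writes
  \<open>\<Sum>k<p. k ^ n\<close> as a \<open>p\<close>-integral combination of positive powers of \<open>p\<close>.
\<close>

section \<open>Faulhaber's formula and harmonic numbers\<close>

lemma bernoulli_sum_eq: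
  "(\<Sum>k\<le>n. of_nat ((n + 1) choose k) * bernoulli k) = (if n = 0 then 1 else 0)"
proof (cases "n = 0")
  case True
  then show ?thesis by (simp add: bernoulli.simps)
next
  case False
  have "bernoulli n * of_nat (n + 1) = - (\<Sum>k<n. of_nat ((n + 1) choose k) * bernoulli k)"
    using False by (subst bernoulli.simps) (simp del: of_nat_Suc of_nat_add)
  moreover have "{..n} = insert n {..<n}" by auto
  ultimately show ?thesis using False by (simp add: algebra_simps)
qed

text \<open>
  The summatory polynomial in Faulhaber's formula is determined by its difference operator: expanding
  \<open>(x + 1) ^ (n + 1 - i)\<close> and collecting powers of \<open>x\<close>, the coefficient of \<open>x ^ l\<close> contains the defining
  recurrence of \<open>bernoulli (n - l)\<close>, so that only \<open>l = n\<close> survives.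
\<close>
lemma bernoulli_poly_difference:
  fixes x :: rat
  shows "(\<Sum>i\<le>n. of_nat ((n + 1) choose i) * bernoulli i * ((x + 1) ^ (n + 1 - i) - x ^ (n + 1 - i)))
           = of_nat (n + 1) * x ^ n"
proof -
  have binom: "(x + 1) ^ (n + 1 - i) - x ^ (n + 1 - i)
      = (\<Sum>l | l \<in> {..n} \<and> i + l \<le> n. of_nat ((n + 1 - i) choose l) * x ^ l)" if "i \<le> n" for i
  proof -
    have "{l \<in> {..n}. i + l \<le> n} = {..<n + 1 - i}" using that by auto
    moreover have "{..n + 1 - i} = insert (n + 1 - i) {..<n + 1 - i}" by auto
    ultimately show ?thesis by (simp add: binomial_ring del: of_nat_Suc)
  qed
  have comm: "((n + 1) choose i) * ((n + 1 - i) choose l) = ((n + 1) choose l) * ((n + 1 - l) choose i)"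
    if "i + l \<le> n" for i l
    using choose_mult[of i "i + l" "n + 1"] choose_mult[of l "i + l" "n + 1"] that
      binomial_symmetric[of i "i + l"] by simp
  have "(\<Sum>i\<le>n. of_nat ((n + 1) choose i) * bernoulli i * ((x + 1) ^ (n + 1 - i) - x ^ (n + 1 - i)))
      = (\<Sum>i\<le>n. \<Sum>l | l \<in> {..n} \<and> i + l \<le> n.
           of_nat (((n + 1) choose i) * ((n + 1 - i) choose l)) * bernoulli i * x ^ l)"
    by (intro sum.cong refl) (simp only: binom atMost_iff sum_distrib_left of_nat_mult mult_ac)
  also have "\<dots> = (\<Sum>l\<le>n. \<Sum>i | i \<in> {..n} \<and> i + l \<le> n.
           of_nat (((n + 1) choose i) * ((n + 1 - i) choose l)) * bernoulli i * x ^ l)"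
    by (rule sum.swap_restrict) auto
  also have "\<dots> = (\<Sum>l\<le>n. of_nat ((n + 1) choose l) * x ^ l *
           (\<Sum>i\<le>n - l. of_nat ((n - l + 1) choose i) * bernoulli i))"
  proof (intro sum.cong refl)
    fix l assume "l \<in> {..n}"
    then have "{i \<in> {..n}. i + l \<le> n} = {..n - l}" by auto
    moreover have "n + 1 - l = n - l + 1" using \<open>l \<in> {..n}\<close> by auto
    ultimately show "(\<Sum>i | i \<in> {..n} \<and> i + l \<le> n.
           of_nat (((n + 1) choose i) * ((n + 1 - i) choose l)) * bernoulli i * x ^ l)
        = of_nat ((n + 1) choose l) * x ^ l *
           (\<Sum>i\<le>n - l. of_nat ((n - l + 1) choose i) * bernoulli i)"
      using \<open>l \<in> {..n}\<close> comm[of _ l] unfolding sum_distrib_left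
      by (intro sum.cong) (auto simp del: of_nat_Suc)
  qed
  also have "\<dots> = (\<Sum>l\<le>n. if l = n then of_nat (n + 1) * x ^ n else 0)"
    by (intro sum.cong refl) (auto simp: bernoulli_sum_eq[simplified])
  finally show ?thesis by simp
qed

lemma faulhaber:
  "of_nat (n + 1) * (\<Sum>k<j. of_nat k ^ n)
     = (\<Sum>i\<le>n. of_nat ((n + 1) choose i) * bernoulli i * of_nat j ^ (n + 1 - i))"
proof (induction j)
  case 0
  have "(\<Sum>i\<le>n. of_nat ((n + 1) choose i) * bernoulli i * of_nat 0 ^ (n + 1 - i)) = 0"
    by (intro sum.neutral) auto
  then show ?case by simp
next
  case (Suc j)
  have "of_nat (n + 1) * (\<Sum>k<Suc j. of_nat k ^ n :: rat)
     = of_nat (n + 1) * (\<Sum>k<j. of_nat k ^ n) + of_nat (n + 1) * of_nat j ^ n"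
    by (simp add: algebra_simps)
  also have "\<dots> = (\<Sum>i\<le>n. of_nat ((n + 1) choose i) * bernoulli i * (of_nat j + 1) ^ (n + 1 - i))"
    unfolding Suc bernoulli_poly_difference[of n "of_nat j", symmetric]
    by (simp add: sum.distrib[symmetric] algebra_simps)
  finally show ?case by (simp add: add.commute)
qed

lemma gen_harm_step: "0 < j \<Longrightarrow> gen_harm s j = gen_harm s (j - 1) + 1 / of_nat j ^ s"
  unfolding gen_harm_def by (cases j) auto

section \<open>The ring of rationals integral at a prime\<close>

text \<open>
  Any representation as a fraction with denominator prime to \<open>p\<close> certifies integrality, which makes the
  ring operations immediate; the lowest-terms representation does not behave well under them.
\<close>
lemma p_integral_iff:
  "p_integral p x \<longleftrightarrow> (\<exists>a b. x = of_int a / of_int b \<and> coprime b (int p))"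
proof
  assume "p_integral p x"
  moreover have "x = of_int (fst (quotient_of x)) / of_int (snd (quotient_of x))"
    using quotient_of_div[of x "fst (quotient_of x)" "snd (quotient_of x)"] by simp
  ultimately show "\<exists>a b. x = of_int a / of_int b \<and> coprime b (int p)"
    unfolding p_integral_def by blast
next
  assume "\<exists>a b. x = of_int a / of_int b \<and> coprime b (int p)"
  then obtain a b where ab: "x = of_int a / of_int b" "coprime b (int p)" by blast
  obtain c d where q: "quotient_of x = (c, d)" by force
  show "p_integral p x"
  proof (cases "b = 0")
    case True
    then show ?thesis using ab by (simp add: p_integral_def)
  next
    case False
    have d: "d > 0" "coprime c d"
      using quotient_of_denom_pos[OF q] quotient_of_coprime[OF q] by auto
    have "(of_int c :: rat) / of_int d = of_int a / of_int b"
      using quotient_of_div[OF q] ab by simp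
    then have "(of_int (c * b) :: rat) = of_int (a * d)"
      using d False by (simp add: field_simps)
    then have "c * b = a * d" by (simp only: of_int_eq_iff)
    then have "d dvd c * b" by simp
    then have "d dvd b" using d by (simp add: coprime_dvd_mult_right_iff coprime_commute)
    then have "coprime d (int p)" using ab(2) by (meson coprime_divisors dvd_refl)
    then show ?thesis using q by (simp add: p_integral_def)
  qed
qed

lemma p_integral_of_int [simp]: "p_integral p (of_int a)"
  unfolding p_integral_iff by (intro exI[of _ a] exI[of _ 1]) simp

lemma p_integral_of_nat [simp]: "p_integral p (of_nat n)"
  using p_integral_of_int[of p "int n"] by simp

lemma p_integral_0 [simp]: "p_integral p 0"
  using p_integral_of_int[of p 0] by simp

lemma p_integral_1 [simp]: "p_integral p 1"
  using p_integral_of_int[of p 1] by simp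

context
  fixes p :: nat
  assumes p: "prime p"
begin

lemma coprime_prime_nonzero: "coprime b (int p) \<Longrightarrow> b \<noteq> 0"
  using p by (auto simp: prime_nat_iff)

lemma p_integral_add [simp]:
  assumes "p_integral p x" "p_integral p y"
  shows "p_integral p (x + y)"
proof -
  obtain a b c d where *: "x = of_int a / of_int b" "coprime b (int p)"
      "y = of_int c / of_int d" "coprime d (int p)"
    using assms unfolding p_integral_iff by metis
  then have "b \<noteq> 0" "d \<noteq> 0" by (simp_all add: coprime_prime_nonzero)
  then have "x + y = of_int (a * d + c * b) / of_int (b * d)"
    using * by (simp add: field_simps)
  moreover have "coprime (b * d) (int p)" using * by simp
  ultimately show ?thesis unfolding p_integral_iff by blast
qed

lemma p_integral_mult [simp]:
  assumes "p_integral p x" "p_integral p y"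
  shows "p_integral p (x * y)"
proof -
  obtain a b c d where *: "x = of_int a / of_int b" "coprime b (int p)"
      "y = of_int c / of_int d" "coprime d (int p)"
    using assms unfolding p_integral_iff by metis
  then have "x * y = of_int (a * c) / of_int (b * d)" by simp
  moreover have "coprime (b * d) (int p)" using * by simp
  ultimately show ?thesis unfolding p_integral_iff by blast
qed

lemma p_integral_uminus [simp]: "p_integral p x \<Longrightarrow> p_integral p (- x)"
  using p_integral_mult[OF p_integral_of_int[of p "- 1"], of x] by simp

lemma p_integral_diff [simp]: "p_integral p x \<Longrightarrow> p_integral p y \<Longrightarrow> p_integral p (x - y)"
  using p_integral_add[of x "- y"] by simp

lemma p_integral_power [simp]: "p_integral p x \<Longrightarrow> p_integral p (x ^ n)"
  by (induction n) auto

lemma p_integral_sum [simp]: "(\<And>i. i \<in> A \<Longrightarrow> p_integral p (f i)) \<Longrightarrow> p_integral p (sum f A)"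
  by (induction A rule: infinite_finite_induct) auto

lemma p_integral_inverse_of_nat:
  assumes "\<not> p dvd n"
  shows "p_integral p (1 / of_nat n)"
proof -
  have "coprime (int n) (int p)"
    using assms p by (metis coprime_commute coprime_int_iff prime_imp_coprime)
  then show ?thesis unfolding p_integral_iff by (intro exI[of _ 1] exI[of _ "int n"]) simp
qed

lemma p_integral_inverse_of_less:
  assumes "0 < n" "n < p"
  shows "p_integral p (1 / of_nat n)"
  using assms by (intro p_integral_inverse_of_nat nat_dvd_not_less)

section \<open>Congruence modulo the prime\<close>

text \<open>
  Congruence is membership of the difference in the ideal generated by \<open>p\<close> in the ring of
  \<open>p\<close>-integral rationals; compatibility with the ring operations follows from this form.
\<close>
lemma rat_cong_iff:
  "rat_cong x y p \<longleftrightarrow>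
     p_integral p x \<and> p_integral p y \<and> (\<exists>z. p_integral p z \<and> x - y = of_nat p * z)"
proof (cases "p_integral p x \<and> p_integral p y")
  case False
  then show ?thesis by (auto simp: rat_cong_def)
next
  case True
  obtain c d where q: "quotient_of (x - y) = (c, d)" by force
  have d: "d > 0" and xy: "x - y = of_int c / of_int d"
    using quotient_of_denom_pos[OF q] quotient_of_div[OF q] by auto
  have cop: "coprime d (int p)"
    using True p_integral_diff[of x y] q by (simp add: p_integral_def)
  have "int p dvd c \<longleftrightarrow> (\<exists>z. p_integral p z \<and> x - y = of_nat p * z)"
  proof
    assume "int p dvd c"
    then obtain k where "c = int p * k" by blast
    then have "x - y = of_nat p * (of_int k / of_int d)" using xy by simp
    moreover have "p_integral p (of_int k / of_int d)"
      using cop unfolding p_integral_iff by blast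
    ultimately show "\<exists>z. p_integral p z \<and> x - y = of_nat p * z" by blast
  next
    assume "\<exists>z. p_integral p z \<and> x - y = of_nat p * z"
    then obtain a b where ab: "x - y = of_nat p * (of_int a / of_int b)" "coprime b (int p)"
      unfolding p_integral_iff by blast
    then have "b \<noteq> 0" by (simp add: coprime_prime_nonzero)
    have "(of_int c :: rat) / of_int d = of_nat p * (of_int a / of_int b)"
      using xy ab by simp
    then have "(of_int (c * b) :: rat) = of_int (int p * (a * d))"
      using \<open>b \<noteq> 0\<close> d by (simp add: field_simps)
    then have "c * b = int p * (a * d)" by (simp only: of_int_eq_iff)
    then have "int p dvd c * b" by simp
    then show "int p dvd c" using ab(2) by (simp add: coprime_dvd_mult_left_iff coprime_commute)
  qed
  then show ?thesis using True q by (simp add: rat_cong_def)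
qed

lemma rat_congI:
  assumes "p_integral p x" "p_integral p y" "p_integral p z" "x - y = of_nat p * z"
  shows "rat_cong x y p"
  using assms unfolding rat_cong_iff by blast

lemma rat_cong_refl: "p_integral p x \<Longrightarrow> rat_cong x x p"
  by (rule rat_congI[of _ _ 0]) auto

lemma rat_cong_sym:
  assumes "rat_cong x y p"
  shows "rat_cong y x p"
proof -
  obtain z where "p_integral p x" "p_integral p y" "p_integral p z" "x - y = of_nat p * z"
    using assms unfolding rat_cong_iff by blast
  then show ?thesis by (intro rat_congI[of _ _ "- z"]) (auto simp: algebra_simps)
qed

lemma rat_cong_add:
  assumes "rat_cong x y p" "rat_cong u v p"
  shows "rat_cong (x + u) (y + v) p"
proof -
  obtain z t where "p_integral p x" "p_integral p y" "p_integral p z" "x - y = of_nat p * z"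
      "p_integral p u" "p_integral p v" "p_integral p t" "u - v = of_nat p * t"
    using assms unfolding rat_cong_iff by blast
  then show ?thesis by (intro rat_congI[of _ _ "z + t"]) (auto simp: algebra_simps)
qed

lemma rat_cong_mult:
  assumes "rat_cong x y p" "rat_cong u v p"
  shows "rat_cong (x * u) (y * v) p"
proof -
  obtain z t where *: "p_integral p x" "p_integral p y" "p_integral p z" "x - y = of_nat p * z"
      "p_integral p u" "p_integral p v" "p_integral p t" "u - v = of_nat p * t"
    using assms unfolding rat_cong_iff by blast
  have "x * u - y * v = (x - y) * u + y * (u - v)" by (simp add: algebra_simps)
  also have "\<dots> = of_nat p * (z * u + y * t)" unfolding * by (simp add: algebra_simps)
  finally show ?thesis using * by (intro rat_congI[of _ _ "z * u + y * t"]) auto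
qed

lemma rat_cong_scale: "p_integral p c \<Longrightarrow> rat_cong x y p \<Longrightarrow> rat_cong (c * x) (c * y) p"
  by (rule rat_cong_mult[OF rat_cong_refl])

lemma rat_cong_diff: "rat_cong x y p \<Longrightarrow> rat_cong u v p \<Longrightarrow> rat_cong (x - u) (y - v) p"
  using rat_cong_add[OF _ rat_cong_scale[of "- 1"], of x y u v] by simp

lemma rat_cong_trans [trans]:
  assumes "rat_cong x y p" "rat_cong y z p"
  shows "rat_cong x z p"
  using rat_cong_diff[OF rat_cong_add[OF assms] rat_cong_refl[of y]] assms(1)
  by (auto simp: rat_cong_iff)

lemma rat_cong_power: "rat_cong x y p \<Longrightarrow> rat_cong (x ^ n) (y ^ n) p"
  by (induction n) (auto intro: rat_cong_mult rat_cong_refl)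

lemma rat_cong_sum:
  "(\<And>i. i \<in> A \<Longrightarrow> rat_cong (f i) (g i) p) \<Longrightarrow> rat_cong (sum f A) (sum g A) p"
  by (induction A rule: infinite_finite_induct) (auto intro: rat_cong_add rat_cong_refl)

lemma rat_cong_prod:
  "(\<And>i. i \<in> A \<Longrightarrow> rat_cong (f i) (g i) p) \<Longrightarrow> rat_cong (prod f A) (prod g A) p"
  by (induction A rule: infinite_finite_induct) (auto intro: rat_cong_mult rat_cong_refl)

lemma rat_cong_inverse:
  assumes "rat_cong x y p" "p_integral p (1 / x)" "p_integral p (1 / y)" "x \<noteq> 0" "y \<noteq> 0"
  shows "rat_cong (1 / x) (1 / y) p"
proof -
  have "rat_cong (1 / x * (1 / y) * y) (1 / x * (1 / y) * x) p"
    using assms by (intro rat_cong_scale rat_cong_sym[OF assms(1)]) (simp del: times_divide_eq_left times_divide_eq_right)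
  then show ?thesis using assms by simp
qed

lemma rat_cong_of_nat: "[m = n] (mod p) \<Longrightarrow> rat_cong (of_nat m) (of_nat n) p"
proof -
  assume "[m = n] (mod p)"
  then have "[int m = int n] (mod int p)" by (simp add: cong_int_iff)
  then obtain k where "int m - int n = int p * k" by (auto simp: cong_iff_dvd_diff)
  then have "(of_int (int m - int n) :: rat) = of_int (int p * k)" by simp
  then show ?thesis by (intro rat_congI[of _ _ "of_int k"]) auto
qed

lemma rat_cong_prime_0: "rat_cong (of_nat p) 0 p"
  by (rule rat_congI[of _ _ 1]) auto

section \<open>Power sums modulo the prime\<close>

text \<open>
  The recurrence for \<open>bernoulli n\<close> divides by \<open>n + 1\<close> only, so the prime \<open>p\<close> cannot enter a denominator before
  index \<open>p - 1\<close>.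
\<close>
lemma p_integral_bernoulli:
  "n + 1 < p \<Longrightarrow> p_integral p (bernoulli n)"
proof (induction n rule: less_induct)
  case (less n)
  have eq: "bernoulli n = (if n = 0 then 1
      else 1 / of_nat (n + 1) * - (\<Sum>k<n. of_nat ((n + 1) choose k) * bernoulli k))"
    by (subst bernoulli.simps) simp
  have "p_integral p (1 / of_nat (n + 1))"
    using less.prems by (intro p_integral_inverse_of_less) auto
  moreover have "p_integral p (\<Sum>k<n. of_nat ((n + 1) choose k) * bernoulli k)"
    using less by (intro p_integral_sum p_integral_mult) auto
  ultimately have "p_integral p (1 / of_nat (n + 1) * - (\<Sum>k<n. of_nat ((n + 1) choose k) * bernoulli k))"
    by (intro p_integral_mult p_integral_uminus)
  with eq show ?case by (metis p_integral_1)
qed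

lemma fermat_rat_cong:
  assumes "0 < j" "j < p"
  shows "rat_cong (of_nat j ^ (p - 1)) 1 p"
  using rat_cong_of_nat[OF fermat_theorem[OF p nat_dvd_not_less[OF assms]]] by simp

text \<open>
  In Faulhaber's formula at \<open>j = p\<close> every term carries a factor \<open>p\<close>, while the coefficients and
  \<open>1 / (n + 1)\<close> are \<open>p\<close>-integral for \<open>n < p - 1\<close>.
\<close>
lemma power_sum_0:
  assumes "0 < n" "n < p - 1"
  shows "rat_cong (\<Sum>j=1..p-1. of_nat j ^ n) 0 p"
proof -
  have "{..<p} = insert 0 {1..p-1}" using assms by auto
  then have "(\<Sum>k<p. of_nat k ^ n :: rat) = (\<Sum>j=1..p-1. of_nat j ^ n)"
    using assms by simp
  then have "(\<Sum>j=1..p-1. of_nat j ^ n :: rat)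
      = 1 / of_nat (n + 1) * (\<Sum>i\<le>n. of_nat ((n + 1) choose i) * bernoulli i * of_nat p ^ (n + 1 - i))"
    using faulhaber[of n p] by (simp add: field_simps del: of_nat_Suc of_nat_add)
  moreover have "rat_cong (1 / of_nat (n + 1) *
      (\<Sum>i\<le>n. of_nat ((n + 1) choose i) * bernoulli i * of_nat p ^ (n + 1 - i)))
      (1 / of_nat (n + 1) * (\<Sum>i\<le>n. of_nat ((n + 1) choose i) * bernoulli i * 0 ^ (n + 1 - i))) p"
    using assms
    by (intro rat_cong_scale rat_cong_sum rat_cong_power p_integral_inverse_of_less
        p_integral_mult p_integral_bernoulli rat_cong_prime_0) auto
  moreover have "(\<Sum>i\<le>n. of_nat ((n + 1) choose i) * bernoulli i * 0 ^ (n + 1 - i)) = 0"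
    by (intro sum.neutral) auto
  ultimately show ?thesis by simp
qed

text \<open>By Fermat's theorem the exponent matters only modulo \<open>p - 1\<close>.\<close>
lemma power_sum_rat_cong:
  "rat_cong (\<Sum>j=1..p-1. of_nat j ^ n) (if p - 1 dvd n then - 1 else 0) p"
proof -
  define r where "r = n mod (p - 1)"
  have p2: "p \<ge> 2" using p prime_ge_2_nat by blast
  have "rat_cong (\<Sum>j=1..p-1. of_nat j ^ n) (\<Sum>j=1..p-1. of_nat j ^ r) p"
  proof (rule rat_cong_sum)
    fix j assume j: "j \<in> {1..p-1}"
    have "n = r + (p - 1) * (n div (p - 1))" unfolding r_def by simp
    then have "(of_nat j :: rat) ^ n = of_nat j ^ r * (of_nat j ^ (p - 1)) ^ (n div (p - 1))"
      by (metis power_add power_mult)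
    moreover have "rat_cong (of_nat j ^ r * (of_nat j ^ (p - 1)) ^ (n div (p - 1)))
        (of_nat j ^ r * 1 ^ (n div (p - 1))) p"
      using j by (intro rat_cong_scale rat_cong_power fermat_rat_cong) auto
    ultimately show "rat_cong (of_nat j ^ n) (of_nat j ^ r) p" by simp
  qed
  moreover have "rat_cong (\<Sum>j=1..p-1. of_nat j ^ r) (if p - 1 dvd n then - 1 else 0) p"
  proof (cases "r = 0")
    case True
    then have "p - 1 dvd n" by (auto simp: r_def)
    moreover have "rat_cong (of_nat (p - 1)) (- 1) p"
      using p2 by (intro rat_congI[of _ _ 1]) (auto simp: of_nat_diff)
    ultimately show ?thesis using True by simp
  next
    case False
    then have "\<not> p - 1 dvd n" by (auto simp: r_def)
    moreover have "r < p - 1" using p2 by (simp add: r_def)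
    ultimately show ?thesis using power_sum_0[of r] False by simp
  qed
  ultimately show ?thesis by (rule rat_cong_trans)
qed

lemma inverse_power_rat_cong:
  assumes "0 < j" "j < p" "s \<le> p - 1"
  shows "rat_cong (1 / of_nat j ^ s) (of_nat j ^ (p - 1 - s)) p"
proof -
  have "(of_nat j :: rat) ^ (p - 1) = of_nat j ^ s * of_nat j ^ (p - 1 - s)"
    using assms by (simp flip: power_add)
  moreover have "rat_cong ((1 / of_nat j) ^ s * of_nat j ^ (p - 1)) ((1 / of_nat j) ^ s * 1) p"
    using assms by (intro rat_cong_scale fermat_rat_cong p_integral_power p_integral_inverse_of_less)
  ultimately show ?thesis
    using assms by (simp add: power_one_over rat_cong_sym)
qed

lemma inverse_power_sum_0:
  assumes "0 < s" "s < p - 1"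
  shows "rat_cong (\<Sum>j=1..p-1. 1 / of_nat j ^ s) 0 p"
proof -
  have "rat_cong (\<Sum>j=1..p-1. 1 / of_nat j ^ s) (\<Sum>j=1..p-1. of_nat j ^ (p - 1 - s)) p"
    using assms by (intro rat_cong_sum inverse_power_rat_cong) auto
  also have "rat_cong (\<Sum>j=1..p-1. of_nat j ^ (p - 1 - s)) 0 p"
    using assms by (intro power_sum_0) auto
  finally show ?thesis .
qed

section \<open>Harmonic sums modulo the prime\<close>

lemma p_integral_inverse_power:
  "0 < j \<Longrightarrow> j < p \<Longrightarrow> p_integral p (1 / of_nat j ^ s)"
  using p_integral_power[OF p_integral_inverse_of_less[of j], of s] by (simp add: power_one_over)

lemma p_integral_gen_harm: "j < p \<Longrightarrow> p_integral p (gen_harm s j)"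
  unfolding gen_harm_def by (intro p_integral_sum p_integral_inverse_power) auto

lemma inverse_power_reflect:
  assumes "0 < k" "k < p"
  shows "rat_cong (1 / of_nat (p - k) ^ s) ((- 1) ^ s * (1 / of_nat k ^ s)) p"
proof -
  have "rat_cong (of_nat (p - k)) (- of_nat k) p"
    using assms by (intro rat_congI[of _ _ 1]) (auto simp: of_nat_diff)
  then have "rat_cong (1 / of_nat (p - k)) (1 / - of_nat k) p"
    using assms p_integral_inverse_of_less[of "p - k"]
      p_integral_uminus[OF p_integral_inverse_of_less[of k]]
    by (intro rat_cong_inverse) auto
  then have "rat_cong ((1 / of_nat (p - k)) ^ s) ((- 1 * (1 / of_nat k)) ^ s) p"
    by (intro rat_cong_power) simp
  then show ?thesis
    by (simp only: power_mult_distrib power_one_over)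
qed

text \<open>
  Reflection turns the terms of the left-hand sum into \<open>(- 1) ^ s / k ^ s\<close> for \<open>j \<le> k < p\<close>. This range is the
  complement of the terms of \<open>gen_harm s (j - 1)\<close> in the full sum, which vanishes modulo \<open>p\<close>; passing to the
  complement is the source of the extra sign.
\<close>
lemma gen_harm_reflect:
  assumes "0 < j" "j < p" "0 < s" "s < p - 1"
  shows "rat_cong (gen_harm s (p - j)) ((- 1) ^ (s + 1) * gen_harm s (j - 1)) p"
proof -
  have "gen_harm s (p - j) = (\<Sum>k=j..p-1. 1 / of_nat (p - k) ^ s)"
    unfolding gen_harm_def using assms
    by (intro sum.reindex_bij_witness[of _ "\<lambda>k. p - k" "\<lambda>k. p - k"]) auto
  also have "rat_cong (\<Sum>k=j..p-1. 1 / of_nat (p - k) ^ s)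
      (\<Sum>k=j..p-1. (- 1) ^ s * (1 / of_nat k ^ s)) p"
    using assms by (intro rat_cong_sum inverse_power_reflect) auto
  also have "(\<Sum>k=j..p-1. (- 1) ^ s * (1 / of_nat k ^ s))
      = (- 1) ^ s * (\<Sum>k=1..p-1. 1 / of_nat k ^ s) + (- 1) ^ (s + 1) * gen_harm s (j - 1)"
  proof -
    have "{1..p-1} = {1..j-1} \<union> {j..p-1}" using assms by auto
    then have "(\<Sum>k=1..p-1. 1 / of_nat k ^ s :: rat)
        = gen_harm s (j - 1) + (\<Sum>k=j..p-1. 1 / of_nat k ^ s)"
      unfolding gen_harm_def using assms by (subst sum.union_disjoint[symmetric]) auto
    then show ?thesis by (simp add: sum_distrib_left algebra_simps)
  qed
  also have "rat_cong ((- 1) ^ s * (\<Sum>k=1..p-1. 1 / of_nat k ^ s)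
        + (- 1) ^ (s + 1) * gen_harm s (j - 1))
      ((- 1) ^ s * 0 + (- 1) ^ (s + 1) * gen_harm s (j - 1)) p"
    using assms
    by (intro rat_cong_add rat_cong_scale inverse_power_sum_0 rat_cong_refl p_integral_mult
        p_integral_power p_integral_uminus p_integral_gen_harm) auto
  finally show ?thesis by simp
qed

text \<open>
  Both sides are values of the polynomial \<open>x gchoose m\<close>, at \<open>p - a\<close> and at \<open>- a\<close>; since \<open>m < p\<close>, its
  coefficients are \<open>p\<close>-integral.
\<close>
lemma binomial_rat_cong:
  assumes "0 < a" "a \<le> p" "m < p"
  shows "rat_cong (of_nat ((p - a) choose m)) ((- 1) ^ m * of_nat ((a + m - 1) choose m)) p"
proof -
  have g: "(x gchoose m) = 1 / of_nat (fact m) * (\<Prod>i=0..<m. x - of_nat i)" for x :: rat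
    by (simp add: gbinomial_prod_rev)
  have "(of_nat p - of_nat a gchoose m :: rat) = of_nat ((p - a) choose m)"
    using assms by (simp add: binomial_gbinomial of_nat_diff)
  moreover have "(- of_nat a gchoose m :: rat) = (- 1) ^ m * of_nat ((a + m - 1) choose m)"
    using assms by (simp add: gbinomial_minus binomial_gbinomial of_nat_diff)
  moreover have "rat_cong (of_nat p - of_nat a gchoose m) (- of_nat a gchoose m) p"
  proof -
    have "\<not> p dvd fact m" using assms p by (simp add: prime_dvd_fact_iff)
    then have *: "p_integral p (1 / of_nat (fact m))" by (rule p_integral_inverse_of_nat)
    show ?thesis unfolding g
    proof (intro rat_cong_scale[OF *] rat_cong_prod)
      fix i
      show "rat_cong (of_nat p - of_nat a - of_nat i) (- of_nat a - of_nat i) p"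
        by (rule rat_congI[of _ _ 1]) auto
    qed
  qed
  ultimately show ?thesis by simp
qed

text \<open>
  Faulhaber's formula makes the harmonic number a polynomial in \<open>j\<close>, and summation over \<open>j\<close> keeps only the
  monomial whose total exponent is divisible by \<open>p - 1\<close>. It is applied to \<open>gen_harm a (j - 1)\<close>, because
  the formula sums over \<open>k < j\<close>; the missing terms \<open>1 / j ^ (a + m)\<close> add up to zero.
\<close>
lemma double_harmonic_sum:
  assumes "0 < a" "0 < m" "a + m < p - 1"
  shows "rat_cong (\<Sum>j=1..p-1. gen_harm a j / of_nat j ^ m)
    ((- 1) ^ m / of_nat (a + m) * of_nat ((a + m) choose a) * bernoulli (p - (a + m))) p"
proof -
  define w where "w = a + m"
  define n where "n = p - 1 - a"
  \<comment> \<open>The coefficients of the summatory polynomial of the \<open>n\<close>-th powers.\<close>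
  define c where "c i = 1 / of_nat (n + 1) * (of_nat ((n + 1) choose i) * bernoulli i)" for i
  have n1: "n + 1 = p - a" "0 < n" using assms by (auto simp: n_def)
  have c_int: "p_integral p (c i)" if "i \<le> n" for i
    unfolding c_def using n1 assms that
    by (intro p_integral_mult p_integral_inverse_of_less p_integral_bernoulli p_integral_of_nat) auto
  have harm: "rat_cong (gen_harm a (j - 1)) (\<Sum>i\<le>n. c i * of_nat j ^ (n + 1 - i)) p"
    if "0 < j" "j < p" for j
  proof -
    have "rat_cong (gen_harm a (j - 1)) (\<Sum>k=1..j-1. of_nat k ^ n) p"
      unfolding gen_harm_def n_def using that assms by (intro rat_cong_sum inverse_power_rat_cong) auto
    moreover have "{..<j} = insert 0 {1..j-1}" using that by auto
    then have "(\<Sum>k=1..j-1. of_nat k ^ n :: rat) = (\<Sum>k<j. of_nat k ^ n)"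
      using n1 by simp
    moreover have "(\<Sum>k<j. of_nat k ^ n) = (\<Sum>i\<le>n. c i * of_nat j ^ (n + 1 - i))"
      using faulhaber[of n j]
      by (simp add: c_def field_simps sum_divide_distrib[symmetric] del: of_nat_Suc of_nat_add)
    ultimately show ?thesis by simp
  qed
  have "(\<Sum>j=1..p-1. gen_harm a j / of_nat j ^ m)
      = (\<Sum>j=1..p-1. gen_harm a (j - 1) * (1 / of_nat j ^ m)) + (\<Sum>j=1..p-1. 1 / of_nat j ^ w)"
    unfolding w_def sum.distrib[symmetric]
    by (intro sum.cong refl) (auto simp: gen_harm_step field_simps power_add)
  also have "rat_cong ((\<Sum>j=1..p-1. gen_harm a (j - 1) * (1 / of_nat j ^ m)) + (\<Sum>j=1..p-1. 1 / of_nat j ^ w))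
     ((\<Sum>j=1..p-1. (\<Sum>i\<le>n. c i * of_nat j ^ (n + 1 - i)) * of_nat j ^ (p - 1 - m)) + 0) p"
    using assms
    by (intro rat_cong_add rat_cong_sum rat_cong_mult harm inverse_power_rat_cong inverse_power_sum_0)
       (auto simp: w_def)
  also have "(\<Sum>j=1..p-1. (\<Sum>i\<le>n. c i * of_nat j ^ (n + 1 - i)) * of_nat j ^ (p - 1 - m)) + 0
      = (\<Sum>i\<le>n. c i * (\<Sum>j=1..p-1. of_nat j ^ (n + 1 - i + (p - 1 - m))))"
    unfolding sum_distrib_right sum_distrib_left add_0_right
    by (subst sum.swap) (simp only: power_add mult_ac)
  also have "rat_cong (\<Sum>i\<le>n. c i * (\<Sum>j=1..p-1. of_nat j ^ (n + 1 - i + (p - 1 - m))))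
      (\<Sum>i\<le>n. c i * (if i = p - w then - 1 else 0)) p"
  proof (intro rat_cong_sum rat_cong_scale)
    fix i assume i: "i \<in> {..n}"
    then show "p_integral p (c i)" by (simp add: c_int)
    define e where "e = n + 1 - i + (p - 1 - m)"
    \<comment> \<open>The exponents stay strictly between \<open>0\<close> and \<open>2 (p - 1)\<close>, so only \<open>p - 1\<close> itself is a multiple.\<close>
    have e: "0 < e" "e < 2 * (p - 1)" "e = p - 1 \<longleftrightarrow> i = p - w"
      using i assms by (auto simp: e_def n_def w_def)
    have "p - 1 dvd e \<longleftrightarrow> i = p - w"
    proof
      assume "p - 1 dvd e"
      then obtain k where k: "e = (p - 1) * k" by blast
      with e have "k \<noteq> 0" "k < 2" by auto
      then have "k = 1" by auto
      then show "i = p - w" using k e by simp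
    qed (use e in auto)
    then show "rat_cong (\<Sum>j=1..p-1. of_nat j ^ (n + 1 - i + (p - 1 - m))) (if i = p - w then - 1 else 0) p"
      using power_sum_rat_cong[of e] by (simp add: e_def)
  qed
  also have "(\<Sum>i\<le>n. c i * (if i = p - w then - 1 else 0)) = - c (p - w)"
  proof -
    have "p - w \<in> {..n}" using assms by (auto simp: w_def n_def)
    moreover have "(\<Sum>i\<le>n. c i * (if i = p - w then - 1 else 0)) = (\<Sum>i\<le>n. if i = p - w then - c i else 0)"
      by (intro sum.cong) auto
    ultimately show ?thesis by simp
  qed
  also have "rat_cong (- c (p - w))
     ((- 1) ^ m / of_nat w * of_nat (w choose a) * bernoulli (p - w)) p"
  proof -
    have "(p - a) choose (p - w) = (p - a) choose m"
      using assms binomial_symmetric[of m "p - a"] by (simp add: w_def)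
    then have "- c (p - w) = 1 / (- of_nat (p - a)) * (of_nat ((p - a) choose m) * bernoulli (p - w))"
      using n1 by (simp add: c_def del: of_nat_diff)
    moreover have "rat_cong (1 / (- of_nat (p - a)) * (of_nat ((p - a) choose m) * bernoulli (p - w)))
      (1 / of_nat a * ((- 1) ^ m * of_nat ((a + m - 1) choose m) * bernoulli (p - w))) p"
    proof (intro rat_cong_mult binomial_rat_cong rat_cong_inverse rat_cong_refl p_integral_bernoulli)
      show "rat_cong (- of_nat (p - a)) (of_nat a) p"
        using assms by (intro rat_congI[of _ _ "- 1"]) (auto simp: of_nat_diff)
      show "p_integral p (1 / - of_nat (p - a))"
        using p_integral_uminus[OF p_integral_inverse_of_less[of "p - a"]] assms
        by (simp del: of_nat_diff)
      show "p_integral p (1 / of_nat a)"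
        using assms by (intro p_integral_inverse_of_less) auto
    qed (use assms in \<open>auto simp: w_def\<close>)
    \<comment> \<open>Absorption: both sides equal \<open>(w - 1)! / (a! m!)\<close>.\<close>
    moreover have "(1 / of_nat a * of_nat ((a + m - 1) choose m) :: rat) = 1 / of_nat w * of_nat (w choose a)"
    proof -
      have "(a + m - 1) choose m = (a + m - 1) choose (a - 1)"
        using assms binomial_symmetric[of m "a + m - 1"] by simp
      moreover have "a * (w choose a) = w * ((a + m - 1) choose (a - 1))"
        using binomial_absorption[of "a - 1" "w"] assms by (simp add: w_def)
      then have "(of_nat (a * (w choose a)) :: rat) = of_nat (w * ((a + m - 1) choose (a - 1)))"
        by (simp only:)
      ultimately show ?thesis using assms by (simp add: w_def field_simps)
    qed
    then have "1 / of_nat a * ((- 1) ^ m * of_nat ((a + m - 1) choose m) * bernoulli (p - w))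
        = (- 1) ^ m / of_nat w * of_nat (w choose a) * bernoulli (p - w)"
      by (simp add: mult_ac)
    ultimately show ?thesis by (simp only:)
  qed
  finally show ?thesis unfolding w_def .
qed

text \<open>
  Let \<open>S\<close> be the sum with two harmonic numbers, and \<open>T\<close> the same sum with \<open>j - 1\<close> in place of \<open>j\<close> in
  both of them. The reflection \<open>j \<mapsto> p - j\<close>
  shows that \<open>S\<close> is congruent to \<open>- T\<close> when the weight is odd, while expanding the product
  expresses \<open>S - T\<close> through sums with one harmonic number. Adding the two relations eliminates \<open>T\<close>.
\<close>
lemma triple_harmonic_sum_reduction:
  assumes "0 < a" "0 < b" "0 < c" "odd (a + b + c)" "a + b + c < p - 1"
  shows "rat_cong (2 * (\<Sum>j=1..p-1. gen_harm a j * gen_harm c j / of_nat j ^ b))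
    ((\<Sum>j=1..p-1. gen_harm a j / of_nat j ^ (b + c)) + (\<Sum>j=1..p-1. gen_harm c j / of_nat j ^ (a + b))) p"
proof -
  define S where "S = (\<Sum>j=1..p-1. gen_harm a j * gen_harm c j / of_nat j ^ b)"
  define T where "T = (\<Sum>j=1..p-1. gen_harm a (j - 1) * gen_harm c (j - 1) / of_nat j ^ b)"
  define D where "D = (\<Sum>j=1..p-1. gen_harm a j / of_nat j ^ (b + c)) + (\<Sum>j=1..p-1. gen_harm c j / of_nat j ^ (a + b))"
  define W where "W = (\<Sum>j=1..p-1. 1 / of_nat j ^ (a + b + c) :: rat)"
  have S_int: "p_integral p S" and D_int: "p_integral p D"
    unfolding S_def D_def
    using p_integral_mult[OF p_integral_gen_harm p_integral_inverse_power]
       p_integral_mult[OF p_integral_mult[OF p_integral_gen_harm p_integral_gen_harm] p_integral_inverse_power]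
    by (auto intro!: p_integral_sum p_integral_add)
  have "S = (\<Sum>j=1..p-1. gen_harm a (p - j) * gen_harm c (p - j) * (1 / of_nat (p - j) ^ b))"
    unfolding S_def by (intro sum.reindex_bij_witness[of _ "\<lambda>k. p - k" "\<lambda>k. p - k"]) auto
  moreover have "rat_cong (\<Sum>j=1..p-1. gen_harm a (p - j) * gen_harm c (p - j) * (1 / of_nat (p - j) ^ b))
     (\<Sum>j=1..p-1. (- 1) ^ (a + 1) * gen_harm a (j - 1) * ((- 1) ^ (c + 1) * gen_harm c (j - 1)) * ((- 1) ^ b * (1 / of_nat j ^ b))) p"
    using assms by (intro rat_cong_sum rat_cong_mult gen_harm_reflect inverse_power_reflect) auto
  moreover have "(\<Sum>j=1..p-1. (- 1) ^ (a + 1) * gen_harm a (j - 1) * ((- 1) ^ (c + 1) * gen_harm c (j - 1)) * ((- 1) ^ b * (1 / of_nat j ^ b))) = - T"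
  proof -
    have "(- 1 :: rat) ^ (a + 1) * (- 1) ^ (c + 1) * (- 1) ^ b = (- 1) ^ (a + b + c)"
      by (simp add: power_add)
    also have "\<dots> = - 1" using assms by simp
    finally have "(- 1 :: rat) ^ (a + 1) * (- 1) ^ (c + 1) * (- 1) ^ b = - 1" .
    then have "(- 1) ^ (a + 1) * x * ((- 1) ^ (c + 1) * y) * ((- 1) ^ b * (1 / z)) = - (x * y / z)" for x y z :: rat
      by (metis (no_types, opaque_lifting) mult.assoc mult.commute mult_minus1 times_divide_eq_right mult.right_neutral)
    then show ?thesis by (simp add: T_def sum_negf del: power_Suc)
  qed
  ultimately have ST: "rat_cong S (- T) p" by simp
  have "S - T = D - W"
    unfolding S_def T_def D_def W_def sum.distrib[symmetric] sum_subtractf[symmetric]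
    by (intro sum.cong refl) (auto simp: gen_harm_step field_simps power_add)
  then have "2 * S = (S - (- T)) + (D - W)" by simp
  also have "rat_cong ((S - (- T)) + (D - W)) ((- T - (- T)) + (D - 0)) p"
    using ST assms S_int D_int inverse_power_sum_0[of "a + b + c"] unfolding W_def
    by (intro rat_cong_add rat_cong_diff rat_cong_refl) (auto simp: rat_cong_iff)
  also have "(- T - (- T)) + (D - 0) = D" by simp
  finally show ?thesis unfolding S_def D_def .
qed

end

theorem theorem2p2:
  fixes s1 s2 s3 w p :: nat
  assumes "s1 > 0" and "s2 > 0" and "s3 > 0"
    and "w = s1 + s2 + s3" and "odd w"
    and "prime p" and "p > w"
  shows "rat_cong
    (\<Sum>j=1..p-1. gen_harm s1 j * gen_harm s3 j / of_nat j ^ s2)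
    (((-1) ^ (s1 + 1) / (2 * of_nat w) * of_nat (w choose s1)
      + ((-1) ^ s3 + 2 * (-1) ^ (s1 + s2)) / (2 * of_nat w) * of_nat (w choose s3))
      * bernoulli (p - w))
    p"
proof -
  note p = \<open>prime p\<close>
  define S where "S = (\<Sum>j=1..p-1. gen_harm s1 j * gen_harm s3 j / of_nat j ^ s2)"
  define E where "E m a = (- 1) ^ m / of_nat w * of_nat (w choose a) * bernoulli (p - w)" for m a :: nat
  \<comment> \<open>Parity excludes \<open>p = w + 1\<close>, the boundary case in which \<open>\<Sum>j. 1 / j ^ w\<close> would not vanish.\<close>
  have "odd p" using p assms by (intro prime_odd_nat) auto
  then have w: "w < p - 1" using assms by (cases "p = w + 1") auto
  have "rat_cong (\<Sum>j=1..p-1. gen_harm s1 j / of_nat j ^ (s2 + s3)) (E (s2 + s3) s1) p"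
    using double_harmonic_sum[OF p, of s1 "s2 + s3"] w assms by (simp add: E_def add.assoc)
  moreover have "rat_cong (\<Sum>j=1..p-1. gen_harm s3 j / of_nat j ^ (s1 + s2)) (E (s1 + s2) s3) p"
    using double_harmonic_sum[OF p, of s3 "s1 + s2"] w assms by (simp add: E_def add_ac)
  ultimately have "rat_cong (2 * S) (E (s2 + s3) s1 + E (s1 + s2) s3) p"
    unfolding S_def using w assms
    by (intro rat_cong_trans[OF p triple_harmonic_sum_reduction[OF p]] rat_cong_add[OF p]) auto
  then have "rat_cong (1 / of_nat 2 * (2 * S)) (1 / of_nat 2 * (E (s2 + s3) s1 + E (s1 + s2) s3)) p"
    using w assms by (intro rat_cong_scale[OF p] p_integral_inverse_of_less[OF p]) auto
  \<comment> \<open>For odd \<open>w\<close> the coefficient \<open>(- 1) ^ s3 + 2 * (- 1) ^ (s1 + s2)\<close> collapses to \<open>(- 1) ^ (s1 + s2)\<close>.\<close>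
  moreover have "(- 1 :: rat) ^ (s2 + s3) = (- 1) ^ (s1 + 1)"
      "(- 1 :: rat) ^ s3 = - ((- 1) ^ (s1 + s2))"
    using assms by (auto simp: minus_one_power_iff)
  then have "1 / of_nat 2 * (E (s2 + s3) s1 + E (s1 + s2) s3)
      = ((-1) ^ (s1 + 1) / (2 * of_nat w) * of_nat (w choose s1)
         + ((-1) ^ s3 + 2 * (-1) ^ (s1 + s2)) / (2 * of_nat w) * of_nat (w choose s3))
        * bernoulli (p - w)"
    unfolding E_def using assms(4) by (simp add: field_simps del: power_Suc of_nat_add)
  ultimately show ?thesis by (simp add: S_def)
qed

end
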